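(* Let $m,p$ be positive integers and let $a,b,x$ be real numbers with $|a|=|b|>1$ and $|x|<|a|^{-1}=|b|^{-1}$. Then \[\begin{aligned} &(-1)^p\sum_{n=1}^\infty\frac{\zeta_n(1;ax)\,\zeta_n(m;b)}{a^n n^p}-(-1)^m\sum_{n=1}^\infty\frac{\zeta_n(1;bx)\,\zeta_n(p;a)}{b^n n^m}\\ &=\sum_{i=1}^{p-1}(-1)^{i-1}\mathrm{Li}_{p+1-i}(ax)\sum_{n=1}^\infty\frac{\zeta_n(m;b)}{n^i}x^n-\sum_{i=1}^{m-1}(-1)^{i-1}\mathrm{Li}_{m+1-i}(bx)\sum_{n=1}^\infty\frac{\zeta_n(p;a)}{n^i}x^n\\ &\quad+(-1)^p\ln(1-ax)\sum_{n=1}^\infty\frac{\zeta_n(m;b)}{n^p}\left(x^n-a^{-n}\right)-(-1)^m\ln(1-bx)\sum_{n=1}^\infty\frac{\zeta_n(p;a)}{n^m}\left(x^n-b^{-n}\right). \end{aligned}\]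
   Context: For positive integers $n,m$ and $c\in\mathbb C$, $\zeta_n(m;c)=\sum_{k=1}^n c^k/k^m$. $\mathrm{Li}_p(t)=\sum_{n\ge1}t^n/n^p$. Empty sums are $0$. *)

theory Defs
  imports "HOL-Analysis.Analysis"
begin

text \<open>Both functions are generic in the field, so that they cover complex arguments
  as well as the real ones.\<close>

definition zeta_n :: "nat \<Rightarrow> nat \<Rightarrow> 'a::real_normed_field \<Rightarrow> 'a" where
  "zeta_n n m c = (\<Sum>k=1..n. c ^ k / of_nat k ^ m)"

text \<open>Library series start at index \<open>0\<close>; a series over \<open>n \<ge> 1\<close> is
  written with the summand at \<open>Suc n\<close>.\<close>

definition Li :: "nat \<Rightarrow> 'a::real_normed_field \<Rightarrow> 'a" where
  "Li p t = (\<Sum>n. t ^ Suc n / of_nat (Suc n) ^ p)"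

end

theory Submission
  imports Defs
begin

text \<open>Put $J_n = \sum_{k \ge 1} a^k x^{n+k} / (k^p (n+k))$, which is
  $\int_0^x t^{n-1} \mathrm{Li}_p(at)\,dt$. The partial fraction decomposition
  $\frac{1}{k(n+k)} = \frac{1}{n} (\frac{1}{k} - \frac{1}{n+k})$ lowers $p$ by one, and iterating it
  expresses $J_n$ through polylogarithms, $\ln(1-ax)$ and $\zeta_n(1;ax)$. On the other hand
  $\sum_n \zeta_n(m;b) J_n$ is the triple sum of $b^j a^k x^{j+k+l} / (j^m k^p (j+k+l))$ over
  $j, k \ge 1$ and $l \ge 0$, which does not change when $(a,p)$ and $(b,m)$ are exchanged.
  Equating the two evaluations gives the theorem. The sums may be separated because
  $\zeta_n(m;b) = O(|b|^n / n)$.\<close>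

section \<open>Logarithm and polylogarithm series\<close>

lemma ln_one_minus_sums:
  fixes t :: real
  assumes "\<bar>t\<bar> < 1"
  shows "(\<lambda>k. t ^ Suc k / real (Suc k)) sums (- ln (1 - t))"
proof -
  \<comment> \<open>The term at n = 0 is 1 / 0, which is 0 by convention, so passing to the summand
    at \<open>Suc k\<close> leaves the value unchanged.\<close>
  have "(\<lambda>n. t ^ n / real n) sums (- ln (1 - t))"
    using sums_minus[OF ln_series'[of "- t"]] assms by simp
  then show ?thesis
    by (subst sums_Suc_iff) simp
qed

lemma Li_sums:
  fixes t :: real
  assumes "\<bar>t\<bar> < 1"
  shows "(\<lambda>k. t ^ Suc k / real (Suc k) ^ p) sums Li p t"
proof -
  have "summable (\<lambda>k. t ^ Suc k / real (Suc k) ^ p)"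
  proof (rule summable_comparison_test')
    show "summable (\<lambda>k. \<bar>t\<bar> ^ Suc k)"
      using assms by (intro summable_Suc_iff[THEN iffD2] summable_geometric) simp
    show "norm (t ^ Suc k / real (Suc k) ^ p) \<le> \<bar>t\<bar> ^ Suc k" for k
      using one_le_power[of "real (Suc k)" p]
      by (simp add: norm_divide norm_mult norm_power divide_le_eq mult_le_cancel_left1
          power_abs del: power_Suc of_nat_Suc)
  qed
  then show ?thesis
    by (simp add: Li_def sums_iff)
qed

lemma Li_1: "\<bar>t\<bar> < 1 \<Longrightarrow> Li 1 t = - ln (1 - t)" for t :: real
  using sums_unique2[OF Li_sums[of t 1]] ln_one_minus_sums[of t] by simp

section \<open>Closed form of the series J_N\<close>

text \<open>Induction on p can start at 0: there the series is a^(-N) times the tail of the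
  logarithm series past its first N terms, which produces ln(1-ax) + zeta_N(1;ax). Each partial
  fraction step adds one polylogarithm and multiplies the previous closed form by -1/N.\<close>

lemma shifted_Li_sums_aux:
  fixes a x :: real
  assumes "\<bar>a * x\<bar> < 1" and "a \<noteq> 0" and "N \<ge> 1"
  shows "(\<lambda>k. a ^ Suc k * x ^ (N + Suc k) / (real (Suc k) ^ p * real (N + Suc k))) sums
    ((\<Sum>i=1..p. (-1) ^ (i - 1) * Li (p + 1 - i) (a * x) * (x ^ N / real N ^ i))
      - (-1) ^ p * (ln (1 - a * x) + zeta_n N 1 (a * x)) / (a ^ N * real N ^ p))"
proof (induction p)
  case 0
  have "(\<lambda>k. (a * x) ^ Suc (k + N) / real (Suc (k + N))) sums
      (- ln (1 - a * x) - (\<Sum>k<N. (a * x) ^ Suc k / real (Suc k)))"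
    using ln_one_minus_sums[OF assms(1)] by (intro sums_split_initial_segment)
  also have "(\<Sum>k<N. (a * x) ^ Suc k / real (Suc k)) = zeta_n N 1 (a * x)"
    unfolding zeta_n_def by (simp add: sum.atLeast1_atMost_eq)
  finally have "(\<lambda>k. (a * x) ^ Suc (k + N) / real (Suc (k + N)) / a ^ N) sums
      ((- ln (1 - a * x) - zeta_n N 1 (a * x)) / a ^ N)"
    by (rule sums_divide)
  moreover have "(a * x) ^ Suc (k + N) / real (Suc (k + N)) / a ^ N
      = a ^ Suc k * x ^ (N + Suc k) / (real (Suc k) ^ 0 * real (N + Suc k))" for k
    using assms(2) by (simp add: power_mult_distrib power_add add.commute)
  ultimately show ?case
    by (simp add: diff_divide_distrib add_divide_distrib)
next
  case (Suc p)
  let ?T = "\<lambda>p k. a ^ Suc k * x ^ (N + Suc k) / (real (Suc k) ^ p * real (N + Suc k))"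
  let ?L = "\<lambda>p i. (-1) ^ (i - 1) * Li (p + 1 - i) (a * x) * (x ^ N / real N ^ i)"
  let ?R = "\<lambda>p. (-1) ^ p * (ln (1 - a * x) + zeta_n N 1 (a * x)) / (a ^ N * real N ^ p)"
  have rec: "?T (Suc p) k = x ^ N / real N * ((a * x) ^ Suc k / real (Suc k) ^ Suc p) - ?T p k / real N"
    for k
  proof -
    have pf: "1 / (s * (M + s)) = 1 / M * (1 / s - 1 / (M + s))" if "s > 0" "M > 0" for s M :: real
      using that by (simp add: field_simps)
    have "?T (Suc p) k = a ^ Suc k * x ^ (N + Suc k) / real (Suc k) ^ p
        * (1 / (real (Suc k) * (real N + real (Suc k))))"
      by (simp add: mult_ac del: of_nat_Suc)
    also have "\<dots> = a ^ Suc k * x ^ (N + Suc k) / real (Suc k) ^ p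
        * (1 / real N * (1 / real (Suc k) - 1 / (real N + real (Suc k))))"
      using assms(3) by (subst pf) auto
    also have "\<dots> = x ^ N / real N * ((a * x) ^ Suc k / real (Suc k) ^ Suc p) - ?T p k / real N"
      by (simp add: right_diff_distrib diff_divide_distrib power_mult_distrib power_add mult_ac
          del: of_nat_Suc add_Suc_right)
    finally show ?thesis .
  qed
  have sums: "(\<lambda>k. x ^ N / real N * ((a * x) ^ Suc k / real (Suc k) ^ Suc p) - ?T p k / real N)
      sums (x ^ N / real N * Li (Suc p) (a * x) - ((\<Sum>i=1..p. ?L p i) - ?R p) / real N)"
    by (intro sums_diff sums_mult sums_divide Li_sums assms(1) Suc)
  \<comment> \<open>The summand i = 1 is the new polylogarithm; the summand i + 1 is the old summand
    i times -1/N.\<close>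
  have L: "(\<Sum>i=1..Suc p. ?L (Suc p) i)
      = x ^ N / real N * Li (Suc p) (a * x) - (\<Sum>i=1..p. ?L p i) / real N"
  proof -
    have "(\<Sum>i=1..Suc p. ?L (Suc p) i) = ?L (Suc p) 1 + (\<Sum>i=1..p. ?L (Suc p) (Suc i))"
      using sum.atLeast_Suc_atMost[of 1 "Suc p" "?L (Suc p)"]
        sum.shift_bounds_cl_Suc_ivl[of "?L (Suc p)" 1 p] by simp
    also have "(\<Sum>i=1..p. ?L (Suc p) (Suc i)) = (\<Sum>i=1..p. - ?L p i / real N)"
    proof (rule sum.cong)
      fix i assume "i \<in> {1..p}"
      \<comment> \<open>As i is a successor, the truncated difference in the sign exponent
        \<open>i - 1\<close> is genuine and the sign flips.\<close>
      then obtain j where "i = Suc j" by (cases i) auto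
      then show "?L (Suc p) (Suc i) = - ?L p i / real N" by simp
    qed simp
    finally show ?thesis
      by (simp add: sum_negf sum_divide_distrib)
  qed
  have R: "?R (Suc p) = - ?R p / real N"
    by simp
  have "x ^ N / real N * Li (Suc p) (a * x) - ((\<Sum>i=1..p. ?L p i) - ?R p) / real N
      = (\<Sum>i=1..Suc p. ?L (Suc p) i) - ?R (Suc p)"
    unfolding L R by (simp add: diff_divide_distrib)
  then show ?case
    using sums by (simp only: rec)
qed

text \<open>For p \<ge> 1 the last summand contains Li_1(ax) = -ln(1-ax). Merged with the logarithm
  already present, it gives the difference x^N - a^(-N).\<close>

lemma shifted_Li_sums:
  fixes a x :: real
  assumes "\<bar>a * x\<bar> < 1" and "a \<noteq> 0" and "N \<ge> 1" and "p \<ge> 1"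
  shows "(\<lambda>k. a ^ Suc k * x ^ (N + Suc k) / (real (Suc k) ^ p * real (N + Suc k))) sums
    ((\<Sum>i=1..p-1. (-1) ^ (i - 1) * Li (p + 1 - i) (a * x) * (x ^ N / real N ^ i))
      + (-1) ^ p * ln (1 - a * x) * ((x ^ N - 1 / a ^ N) / real N ^ p)
      - (-1) ^ p * (zeta_n N 1 (a * x) / (a ^ N * real N ^ p)))"
proof -
  obtain q where q: "p = Suc q"
    using assms(4) by (cases p) auto
  have "Li (Suc 0) (a * x) = - ln (1 - a * x)"
    using Li_1[OF assms(1)] by simp
  moreover have "(\<Sum>i=1..p. (-1) ^ (i - 1) * Li (p + 1 - i) (a * x) * (x ^ N / real N ^ i))
    = (\<Sum>i=1..p-1. (-1) ^ (i - 1) * Li (p + 1 - i) (a * x) * (x ^ N / real N ^ i))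
      + (-1) ^ (p - 1) * Li 1 (a * x) * (x ^ N / real N ^ p)"
    unfolding q by simp
  ultimately have "(\<Sum>i=1..p. (-1) ^ (i - 1) * Li (p + 1 - i) (a * x) * (x ^ N / real N ^ i))
      - (-1) ^ p * (ln (1 - a * x) + zeta_n N 1 (a * x)) / (a ^ N * real N ^ p)
    = (\<Sum>i=1..p-1. (-1) ^ (i - 1) * Li (p + 1 - i) (a * x) * (x ^ N / real N ^ i))
      + (-1) ^ p * ln (1 - a * x) * ((x ^ N - 1 / a ^ N) / real N ^ p)
      - (-1) ^ p * (zeta_n N 1 (a * x) / (a ^ N * real N ^ p))"
    unfolding q
    by (simp add: diff_divide_distrib add_divide_distrib right_diff_distrib distrib_left mult_ac)
  then show ?thesis
    using shifted_Li_sums_aux[OF assms(1-3), of p] by simp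
qed

section \<open>The triple sum and its symmetry\<close>

text \<open>Expanding the partial sum over j \<le> n and writing n = j + l turns the double sum into
  a sum over all triples (j, k, l). Rearrangement is legitimate because the terms are dominated by a
  product of three absolutely convergent series, the one in l being geometric. Indices start at 0,
  whence the shift by 2.\<close>

lemma double_sum_as_triple_sum:
  fixes \<alpha> \<beta> :: "nat \<Rightarrow> real" and x :: real
  assumes \<alpha>: "summable (\<lambda>k. \<bar>\<alpha> k * x ^ k\<bar>)" and \<beta>: "summable (\<lambda>j. \<bar>\<beta> j * x ^ j\<bar>)"
    and x: "\<bar>x\<bar> < 1"
  defines "f \<equiv> \<lambda>(j, k, l). \<beta> j * \<alpha> k * x ^ (j + k + l + 2) / real (j + k + l + 2)"
  shows "(\<lambda>n. (\<Sum>j\<le>n. \<beta> j) * (\<Sum>k. \<alpha> k * x ^ (n + k + 2) / real (n + k + 2))) sums infsum f UNIV"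
proof -
  have weight: "\<bar>y / real (i + 2)\<bar> \<le> \<bar>y\<bar>" for y i
    by (simp add: abs_divide divide_le_eq mult_le_cancel_left1)
  have l: "(\<lambda>l. norm (x ^ l)) summable_on UNIV"
    using x by (intro norm_summable_imp_summable_on) (simp add: power_abs summable_geometric)
  have A: "(\<lambda>k. norm (\<alpha> k * x ^ k)) summable_on UNIV" and B: "(\<lambda>j. norm (\<beta> j * x ^ j)) summable_on UNIV"
    using \<alpha> \<beta> by (auto intro!: norm_summable_imp_summable_on)
  \<comment> \<open>The index type of G is left general so that the fact can be applied twice, the
    second time with pairs as the inner index.\<close>
  have prod: "(\<lambda>z. norm (case z of (i, j) \<Rightarrow> F i * G j)) summable_on UNIV"
    if "(\<lambda>i. norm (F i)) summable_on UNIV" "(\<lambda>j. norm (G j)) summable_on UNIV" for F :: "nat \<Rightarrow> real" and G :: "'b \<Rightarrow> real"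
  proof -
    have "(\<lambda>(i, j). norm (F i) * norm (G j)) summable_on Sigma UNIV (\<lambda>_. UNIV)"
      using that
      by (intro summable_on_SigmaI[where g = "\<lambda>i. norm (F i) * infsum (\<lambda>j. norm (G j)) UNIV"]
          summable_on_cmult_left) (auto intro!: has_sum_cmult_right has_sum_infsum)
    then show ?thesis
      by (simp add: abs_mult case_prod_unfold)
  qed
  have "(\<lambda>z. norm (case z of (j, k, l) \<Rightarrow> (\<beta> j * x ^ j) * ((\<alpha> k * x ^ k) * x ^ l)))
      summable_on UNIV"
    using prod[OF B prod[OF A l]] by (simp add: case_prod_unfold)
  then have "(\<lambda>z. norm (f z)) summable_on UNIV"
  proof (rule Infinite_Sum.abs_summable_on_comparison_test)
    fix z :: "nat \<times> nat \<times> nat"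
    obtain j k l where z: "z = (j, k, l)"
      by (cases z)
    have "norm (f (j, k, l)) \<le> \<bar>\<beta> j * \<alpha> k * x ^ (j + k + l + 2)\<bar>"
      unfolding f_def using weight[of _ "j + k + l"] by simp
    also have "\<dots> = \<bar>\<beta> j * \<alpha> k * x ^ (j + k + l)\<bar> * \<bar>x\<bar> ^ 2"
      by (simp add: power_add abs_mult power_abs power2_eq_square mult_ac)
    also have "\<dots> \<le> \<bar>\<beta> j * \<alpha> k * x ^ (j + k + l)\<bar> * 1"
      using x by (intro mult_left_mono power_le_one) auto
    finally show "norm (f z) \<le> norm (case z of (j, k, l) \<Rightarrow>
        (\<beta> j * x ^ j) * ((\<alpha> k * x ^ k) * x ^ l))"
      by (simp add: z power_add mult_ac)
  qed
  then have summ: "f summable_on UNIV"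
    by (rule abs_summable_summable)
  define S where "S = infsum f UNIV"
  define g where "g = (\<lambda>((n, k), j). \<beta> j * \<alpha> k * x ^ (n + k + 2) / real (n + k + 2))"
  have "(f has_sum S) UNIV"
    using summ unfolding S_def by (rule has_sum_infsum)
  \<comment> \<open>Here l becomes n - j, so that j ranges over the finite set {..n}. Keeping (n, k)
    as the outer index lets j be summed first, and k after it.\<close>
  also have "(f has_sum S) UNIV \<longleftrightarrow> (g has_sum S) (Sigma (UNIV \<times> UNIV) (\<lambda>(n, k). {..n}))"
    by (rule has_sum_reindex_bij_witness
        [of _ "\<lambda>((n, k), j). (j, k, n - j)" "\<lambda>(j, k, l). ((j + l, k), j)"])
      (auto simp: f_def g_def ac_simps)
  finally have "((\<lambda>(n, k). (\<Sum>j\<le>n. \<beta> j) * (\<alpha> k * x ^ (n + k + 2) / real (n + k + 2))) has_sum S)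
      (UNIV \<times> UNIV)"
    by (rule has_sum_SigmaD)
      (auto simp: g_def sum_distrib_right sum_divide_distrib mult.assoc intro!: has_sum_finiteI)
  then have "((\<lambda>n. (\<Sum>j\<le>n. \<beta> j) * (\<Sum>k. \<alpha> k * x ^ (n + k + 2) / real (n + k + 2))) has_sum S) UNIV"
  proof (rule has_sum_SigmaD)
    fix n
    have "summable (\<lambda>k. norm (\<alpha> k * x ^ (n + k + 2) / real (n + k + 2)))"
    proof (rule summable_comparison_test'[OF \<alpha>])
      fix k
      have "norm (\<alpha> k * x ^ (n + k + 2) / real (n + k + 2)) \<le> \<bar>\<alpha> k * x ^ (n + k + 2)\<bar>"
        using weight[of _ "n + k"] by simp
      also have "\<dots> = \<bar>\<alpha> k * x ^ k\<bar> * \<bar>x\<bar> ^ (n + 2)"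
        by (simp add: power_add abs_mult power_abs mult_ac)
      also have "\<dots> \<le> \<bar>\<alpha> k * x ^ k\<bar> * 1"
        using x by (intro mult_left_mono power_le_one) auto
      finally show "norm (norm (\<alpha> k * x ^ (n + k + 2) / real (n + k + 2))) \<le> \<bar>\<alpha> k * x ^ k\<bar>"
        by simp
    qed
    then have "((\<lambda>k. \<alpha> k * x ^ (n + k + 2) / real (n + k + 2)) has_sum
        (\<Sum>k. \<alpha> k * x ^ (n + k + 2) / real (n + k + 2))) UNIV"
      by (intro norm_summable_imp_has_sum) (auto simp: summable_norm_cancel summable_sums)
    then show "((\<lambda>k. case (n, k) of (n, k) \<Rightarrow>
        (\<Sum>j\<le>n. \<beta> j) * (\<alpha> k * x ^ (n + k + 2) / real (n + k + 2))) has_sum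
        (\<Sum>j\<le>n. \<beta> j) * (\<Sum>k. \<alpha> k * x ^ (n + k + 2) / real (n + k + 2))) UNIV"
      unfolding prod.case by (rule has_sum_cmult_right)
  qed
  then show "(\<lambda>n. (\<Sum>j\<le>n. \<beta> j) * (\<Sum>k. \<alpha> k * x ^ (n + k + 2) / real (n + k + 2))) sums infsum f UNIV"
    unfolding S_def by (rule has_sum_imp_sums)
qed

text \<open>In the triple sum the power and the denominator depend only on j + k + l, so exchanging
  j and k amounts to exchanging \<alpha> and \<beta>.\<close>

lemma double_sum_symmetric:
  fixes \<alpha> \<beta> :: "nat \<Rightarrow> real" and x :: real
  assumes \<alpha>: "summable (\<lambda>k. \<bar>\<alpha> k * x ^ k\<bar>)" and \<beta>: "summable (\<lambda>j. \<bar>\<beta> j * x ^ j\<bar>)"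
    and x: "\<bar>x\<bar> < 1"
  shows "(\<Sum>n. (\<Sum>j\<le>n. \<beta> j) * (\<Sum>k. \<alpha> k * x ^ (n + k + 2) / real (n + k + 2)))
    = (\<Sum>n. (\<Sum>j\<le>n. \<alpha> j) * (\<Sum>k. \<beta> k * x ^ (n + k + 2) / real (n + k + 2)))"
proof -
  let ?f = "\<lambda>\<alpha> \<beta> (j, k, l). \<beta> j * \<alpha> k * x ^ (j + k + l + 2) / real (j + k + l + 2)"
  have "infsum (?f \<alpha> \<beta>) UNIV = infsum (?f \<beta> \<alpha>) UNIV"
    by (rule infsum_reindex_bij_witness[of _ "\<lambda>(j, k, l). (k, j, l)" "\<lambda>(j, k, l). (k, j, l)"])
      (auto simp: ac_simps)
  then show ?thesis
    using double_sum_as_triple_sum[OF \<alpha> \<beta> x] double_sum_as_triple_sum[OF \<beta> \<alpha> x]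
    by (simp only: sums_iff)
qed

section \<open>Growth of the finite sums and convergence\<close>

text \<open>The last terms dominate: 1/k \<le> (n-k+1)/n, so with r = 1/|b| and d = n - k the sum is
  at most |b|^n / n times the convergent series of (d+1) r^d, whose value serves as C. The gain of
  1/n over the geometric growth secures convergence later when |a| = |b| and p = 1.\<close>

lemma zeta_n_bound:
  fixes b :: real
  assumes "\<bar>b\<bar> > 1" and "m \<ge> 1"
  obtains C where "C \<ge> 0" and "\<And>n. n \<ge> 1 \<Longrightarrow> \<bar>zeta_n n m b\<bar> \<le> C * \<bar>b\<bar> ^ n / real n"
proof
  define r where "r = 1 / \<bar>b\<bar>"
  have r: "0 < r" "r < 1"
    using assms(1) by (auto simp: r_def)
  have summ: "summable (\<lambda>d. real (Suc d) * r ^ d)"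
    using geometric_deriv_sums[of r] r by (simp add: sums_iff)
  show "0 \<le> (\<Sum>d. real (Suc d) * r ^ d)"
    using r by (intro suminf_nonneg summ) auto
  fix n :: nat
  assume n: "n \<ge> 1"
  have "\<bar>zeta_n n m b\<bar> \<le> (\<Sum>k=1..n. \<bar>b ^ k / real k ^ m\<bar>)"
    unfolding zeta_n_def by (rule sum_abs)
  also have "\<dots> \<le> (\<Sum>k=1..n. real (Suc (n - k)) * r ^ (n - k) * (\<bar>b\<bar> ^ n / real n))"
  proof (rule sum_mono)
    fix k assume k: "k \<in> {1..n}"
    have "\<bar>b ^ k / real k ^ m\<bar> \<le> \<bar>b\<bar> ^ k / real k"
      using k assms(2) self_le_power[of "real k" m]
      by (auto simp: abs_divide power_abs intro!: divide_left_mono)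
    also have "\<dots> \<le> \<bar>b\<bar> ^ k * (real (Suc (n - k)) / real n)"
    proof -
      \<comment> \<open>With n = k + d this reads k + d \<le> (d+1) k, that is, d \<le> d k.\<close>
      have "real n \<le> real (Suc (n - k)) * real k"
      proof (subst of_nat_mult[symmetric], subst of_nat_le_iff)
        obtain d where d: "n = k + d"
          using k le_Suc_ex by auto
        have "d * 1 \<le> d * k"
          using k by (intro mult_left_mono) auto
        then show "n \<le> Suc (n - k) * k"
          using d by simp
      qed
      then have "1 / real k \<le> real (Suc (n - k)) / real n"
        using k by (simp add: divide_simps mult.commute del: of_nat_Suc)
      then show ?thesis
        using mult_left_mono[of "1 / real k" "real (Suc (n - k)) / real n" "\<bar>b\<bar> ^ k"]
        by (simp del: of_nat_Suc)
    qed
    also have "\<dots> = real (Suc (n - k)) * r ^ (n - k) * (\<bar>b\<bar> ^ n / real n)"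
      using k assms(1) by (simp add: r_def power_divide power_diff field_simps)
    finally show "\<bar>b ^ k / real k ^ m\<bar> \<le> \<dots>" .
  qed
  also have "\<dots> = (\<Sum>k=1..n. real (Suc (n - k)) * r ^ (n - k)) * (\<bar>b\<bar> ^ n / real n)"
    by (simp only: sum_distrib_right)
  also have "(\<Sum>k=1..n. real (Suc (n - k)) * r ^ (n - k)) = (\<Sum>d<n. real (Suc d) * r ^ d)"
    by (rule sum.reindex_bij_witness[of _ "\<lambda>d. n - d" "\<lambda>k. n - k"]) auto
  also have "\<dots> \<le> (\<Sum>d. real (Suc d) * r ^ d)"
    using r by (intro sum_le_suminf summ) auto
  finally show "\<bar>zeta_n n m b\<bar> \<le> (\<Sum>d. real (Suc d) * r ^ d) * \<bar>b\<bar> ^ n / real n"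
    by (simp add: mult_right_mono divide_right_mono)
qed


text \<open>Comparison with the geometric series gives a bound uniform in n, so these sums can act
  as a bounded weight in \<open>summable_bounded_zeta_n\<close>.\<close>

lemma zeta_n_1_bound:
  fixes t :: real
  assumes "\<bar>t\<bar> < 1"
  shows "\<bar>zeta_n n 1 t\<bar> \<le> 1 / (1 - \<bar>t\<bar>)"
proof -
  have "\<bar>zeta_n n 1 t\<bar> \<le> (\<Sum>k=1..n. \<bar>t ^ k / real k ^ 1\<bar>)"
    unfolding zeta_n_def by (rule sum_abs)
  also have "\<dots> \<le> (\<Sum>k=1..n. \<bar>t\<bar> ^ k)"
    by (intro sum_mono) (auto simp: abs_divide power_abs divide_le_eq mult_le_cancel_left1)
  also have "\<dots> \<le> (\<Sum>k. \<bar>t\<bar> ^ k)"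
    using assms by (intro sum_le_suminf summable_geometric) auto
  also have "\<dots> = 1 / (1 - \<bar>t\<bar>)"
    using assms by (intro suminf_geometric) auto
  finally show ?thesis .
qed

lemma summable_zeta_n_power:
  fixes b x :: real
  assumes "\<bar>b\<bar> > 1" and "m \<ge> 1" and "\<bar>b * x\<bar> < 1"
  shows "summable (\<lambda>n. zeta_n (Suc n) m b / real (Suc n) ^ i * x ^ Suc n)"
proof -
  obtain C where C: "C \<ge> 0" "\<And>n. n \<ge> 1 \<Longrightarrow> \<bar>zeta_n n m b\<bar> \<le> C * \<bar>b\<bar> ^ n / real n"
    using zeta_n_bound assms(1,2) by blast
  show ?thesis
  proof (rule summable_comparison_test')
    show "summable (\<lambda>n. C * \<bar>b * x\<bar> ^ Suc n)"
      using assms(3) by (intro summable_mult summable_Suc_iff[THEN iffD2] summable_geometric) simp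
    fix n
    have "\<bar>zeta_n (Suc n) m b\<bar> \<le> C * \<bar>b\<bar> ^ Suc n"
      using C(2)[of "Suc n"] C(1)
        divide_left_mono[of 1 "real (Suc n)" "C * \<bar>b\<bar> ^ Suc n"]
      by simp
    then have "\<bar>zeta_n (Suc n) m b\<bar> / real (Suc n) ^ i \<le> C * \<bar>b\<bar> ^ Suc n / 1"
      by (intro frac_le) (auto simp del: of_nat_Suc)
    then have "\<bar>zeta_n (Suc n) m b\<bar> / real (Suc n) ^ i * \<bar>x\<bar> ^ Suc n \<le> C * \<bar>b\<bar> ^ Suc n * \<bar>x\<bar> ^ Suc n"
      by (intro mult_right_mono) auto
    then show "norm (zeta_n (Suc n) m b / real (Suc n) ^ i * x ^ Suc n) \<le> C * \<bar>b * x\<bar> ^ Suc n"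
      by (simp add: abs_mult abs_divide power_abs power_mult_distrib mult.assoc del: power_Suc of_nat_Suc)
  qed
qed

text \<open>Since |a| = |b|, the exponential factors cancel. One factor 1/n from
  \<open>zeta_n_bound\<close> and another from n^p with p \<ge> 1 give terms of order 1/n^2. The
  weight w is later the constant 1 or zeta_n(1;ax).\<close>

lemma summable_bounded_zeta_n:
  fixes a b :: real and w :: "nat \<Rightarrow> real"
  assumes "\<bar>a\<bar> = \<bar>b\<bar>" and "\<bar>b\<bar> > 1" and "m \<ge> 1" and "p \<ge> 1" and w: "\<And>n. \<bar>w n\<bar> \<le> W"
  shows "summable (\<lambda>n. w n * zeta_n (Suc n) m b / (a ^ Suc n * real (Suc n) ^ p))"
proof -
  obtain C where C: "C \<ge> 0" "\<And>n. n \<ge> 1 \<Longrightarrow> \<bar>zeta_n n m b\<bar> \<le> C * \<bar>b\<bar> ^ n / real n"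
    using zeta_n_bound assms(2,3) by blast
  show ?thesis
  proof (rule summable_comparison_test')
    show "summable (\<lambda>n. W * C * inverse (real (Suc n) ^ 2))"
      by (intro summable_mult summable_Suc_iff[THEN iffD2] inverse_power_summable) simp
    fix n
    have W: "W \<ge> 0"
      using w[of 0] by simp
    have "norm (w n * zeta_n (Suc n) m b / (a ^ Suc n * real (Suc n) ^ p))
        = \<bar>w n\<bar> * (\<bar>zeta_n (Suc n) m b\<bar> / (\<bar>b\<bar> ^ Suc n * real (Suc n) ^ p))"
      by (simp add: abs_mult abs_divide power_abs assms(1) del: power_Suc of_nat_Suc)
    also have "\<dots> \<le> W * ((C * \<bar>b\<bar> ^ Suc n / real (Suc n)) / (\<bar>b\<bar> ^ Suc n * real (Suc n) ^ 1))"
      using W w assms(2,4) C(1)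
      by (intro mult_mono frac_le C(2) mult_left_mono power_increasing) auto
    also have "\<dots> = W * C * inverse (real (Suc n) ^ 2)"
      using assms(2) by (simp add: divide_inverse power2_eq_square mult_ac del: of_nat_Suc)
    finally show "norm (w n * zeta_n (Suc n) m b / (a ^ Suc n * real (Suc n) ^ p)) \<le> \<dots>" .
  qed
qed

section \<open>Summation against zeta_n(m;b) and conclusion\<close>

text \<open>Inserting the closed form of J_n gives finitely many series in n, each convergent on its
  own, so the sum may be split termwise.\<close>

lemma zeta_n_shifted_Li_suminf:
  fixes a b x :: real
  assumes "m \<ge> 1" and "p \<ge> 1" and "\<bar>a\<bar> = \<bar>b\<bar>" and "\<bar>b\<bar> > 1" and "\<bar>a * x\<bar> < 1"
  shows "(\<Sum>n. zeta_n (Suc n) m b *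
        (\<Sum>k. a ^ Suc k / real (Suc k) ^ p * x ^ (n + k + 2) / real (n + k + 2)))
    = (\<Sum>i=1..p-1. (-1) ^ (i - 1) * Li (p + 1 - i) (a * x)
        * (\<Sum>n. zeta_n (Suc n) m b / real (Suc n) ^ i * x ^ Suc n))
      + (-1) ^ p * ln (1 - a * x)
        * (\<Sum>n. zeta_n (Suc n) m b / real (Suc n) ^ p * (x ^ Suc n - 1 / a ^ Suc n))
      - (-1) ^ p * (\<Sum>n. zeta_n (Suc n) 1 (a * x) * zeta_n (Suc n) m b
        / (a ^ Suc n * real (Suc n) ^ p))"
proof -
  let ?Z = "\<lambda>n. zeta_n (Suc n) m b"
  let ?c = "\<lambda>i. (-1) ^ (i - 1) * Li (p + 1 - i) (a * x)"
  have bx: "\<bar>b * x\<bar> < 1"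
    using assms(3,5) by (simp add: abs_mult)
  have a: "a \<noteq> 0"
    using assms(3,4) by auto
  \<comment> \<open>The closed form is used at N = n + 1, where N + \<open>Suc k\<close> is n + k +
    2.\<close>
  have inner: "(\<Sum>k. a ^ Suc k / real (Suc k) ^ p * x ^ (n + k + 2) / real (n + k + 2))
      = (\<Sum>i=1..p-1. ?c i * (x ^ Suc n / real (Suc n) ^ i))
        + (-1) ^ p * ln (1 - a * x) * ((x ^ Suc n - 1 / a ^ Suc n) / real (Suc n) ^ p)
        - (-1) ^ p * (zeta_n (Suc n) 1 (a * x) / (a ^ Suc n * real (Suc n) ^ p))" for n
    using shifted_Li_sums[OF assms(5) a _ assms(2), of "Suc n", THEN sums_unique, symmetric]
    by (simp del: power_Suc of_nat_Suc)
  \<comment> \<open>The explicit factor 1 is the constant weight w. The two parts of x^n - a^(-n)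
    converge separately, for different reasons: |bx| < 1 for the first, decay like 1/n^2 for the
    second.\<close>
  have "summable (\<lambda>n. ?Z n / real (Suc n) ^ p * x ^ Suc n - 1 * ?Z n / (a ^ Suc n * real (Suc n) ^ p))"
    by (intro summable_diff summable_zeta_n_power summable_bounded_zeta_n[where W = 1] assms bx) auto
  then have s2: "summable (\<lambda>n. ?Z n / real (Suc n) ^ p * (x ^ Suc n - 1 / a ^ Suc n))"
    by (simp add: right_diff_distrib diff_divide_distrib mult.commute del: power_Suc of_nat_Suc)
  have s3: "summable (\<lambda>n. zeta_n (Suc n) 1 (a * x) * ?Z n / (a ^ Suc n * real (Suc n) ^ p))"
    by (intro summable_bounded_zeta_n[where W = "1 / (1 - \<bar>a * x\<bar>)"] assms zeta_n_1_bound)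
  have "(\<lambda>n. (\<Sum>i=1..p-1. ?c i * (?Z n / real (Suc n) ^ i * x ^ Suc n))
        + (-1) ^ p * ln (1 - a * x) * (?Z n / real (Suc n) ^ p * (x ^ Suc n - 1 / a ^ Suc n))
        - (-1) ^ p * (zeta_n (Suc n) 1 (a * x) * ?Z n / (a ^ Suc n * real (Suc n) ^ p))) sums
     ((\<Sum>i=1..p-1. ?c i * (\<Sum>n. ?Z n / real (Suc n) ^ i * x ^ Suc n))
      + (-1) ^ p * ln (1 - a * x) * (\<Sum>n. ?Z n / real (Suc n) ^ p * (x ^ Suc n - 1 / a ^ Suc n))
      - (-1) ^ p * (\<Sum>n. zeta_n (Suc n) 1 (a * x) * ?Z n / (a ^ Suc n * real (Suc n) ^ p)))"
    by (intro sums_diff sums_add sums_sum sums_mult summable_sums s2 s3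
        summable_zeta_n_power assms bx)
  also have "(\<lambda>n. (\<Sum>i=1..p-1. ?c i * (?Z n / real (Suc n) ^ i * x ^ Suc n))
        + (-1) ^ p * ln (1 - a * x) * (?Z n / real (Suc n) ^ p * (x ^ Suc n - 1 / a ^ Suc n))
        - (-1) ^ p * (zeta_n (Suc n) 1 (a * x) * ?Z n / (a ^ Suc n * real (Suc n) ^ p)))
      = (\<lambda>n. ?Z n *
        (\<Sum>k. a ^ Suc k / real (Suc k) ^ p * x ^ (n + k + 2) / real (n + k + 2)))"
    unfolding inner
    by (intro ext) (simp add: right_diff_distrib distrib_left sum_distrib_left mult_ac
        del: power_Suc of_nat_Suc)
  finally show ?thesis
    by (rule sums_unique[symmetric])
qed

theorem theorem3p4:
  fixes m p :: nat and a b x :: real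
  assumes "m \<ge> 1" and "p \<ge> 1"
    and "\<bar>a\<bar> = \<bar>b\<bar>" and "\<bar>b\<bar> > 1"
    and "\<bar>x\<bar> < 1 / \<bar>a\<bar>"
  shows
    "(-1) ^ p * (\<Sum>n. zeta_n (Suc n) 1 (a * x) * zeta_n (Suc n) m b
                        / (a ^ Suc n * real (Suc n) ^ p))
     - (-1) ^ m * (\<Sum>n. zeta_n (Suc n) 1 (b * x) * zeta_n (Suc n) p a
                        / (b ^ Suc n * real (Suc n) ^ m))
     = (\<Sum>i=1..p-1. (-1) ^ (i - 1) * Li (p + 1 - i) (a * x)
                        * (\<Sum>n. zeta_n (Suc n) m b / real (Suc n) ^ i * x ^ Suc n))
     - (\<Sum>i=1..m-1. (-1) ^ (i - 1) * Li (m + 1 - i) (b * x)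
                        * (\<Sum>n. zeta_n (Suc n) p a / real (Suc n) ^ i * x ^ Suc n))
     + (-1) ^ p * ln (1 - a * x)
         * (\<Sum>n. zeta_n (Suc n) m b / real (Suc n) ^ p * (x ^ Suc n - 1 / a ^ Suc n))
     - (-1) ^ m * ln (1 - b * x)
         * (\<Sum>n. zeta_n (Suc n) p a / real (Suc n) ^ m * (x ^ Suc n - 1 / b ^ Suc n))"
proof -
  have ab: "\<bar>a\<bar> > 1"
    using assms(3,4) by simp
  have ax: "\<bar>a * x\<bar> < 1"
    using assms(5) ab by (simp add: abs_mult pos_less_divide_eq mult.commute)
  have bx: "\<bar>b * x\<bar> < 1"
    using ax assms(3) by (simp add: abs_mult)
  \<comment> \<open>The bound |x| < 1 that follows makes the sum over l in the triple sum converge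
    absolutely.\<close>
  have "1 / \<bar>a\<bar> < 1"
    using ab by simp
  then have x: "\<bar>x\<bar> < 1"
    using assms(5) by linarith
  have summ: "summable (\<lambda>k. \<bar>c ^ Suc k / real (Suc k) ^ q * x ^ k\<bar>)" if "\<bar>c * x\<bar> < 1" for c q
  proof (rule summable_comparison_test')
    show "summable (\<lambda>k. \<bar>c\<bar> * \<bar>c * x\<bar> ^ k)"
      using that by (intro summable_mult summable_geometric) simp
    fix k
    have "\<bar>c ^ Suc k / real (Suc k) ^ q * x ^ k\<bar> = \<bar>c\<bar> * \<bar>c * x\<bar> ^ k / real (Suc k) ^ q"
      by (simp add: abs_mult abs_divide power_abs power_mult_distrib del: of_nat_Suc)
    also have "\<dots> \<le> \<bar>c\<bar> * \<bar>c * x\<bar> ^ k / 1"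
      by (intro divide_left_mono) (auto simp del: of_nat_Suc)
    finally show "norm \<bar>c ^ Suc k / real (Suc k) ^ q * x ^ k\<bar> \<le> \<bar>c\<bar> * \<bar>c * x\<bar> ^ k"
      by simp
  qed
  have zeta: "(\<Sum>j\<le>n. c ^ Suc j / real (Suc j) ^ q) = zeta_n (Suc n) q c" for c :: real and q n
    unfolding zeta_n_def by (simp only: One_nat_def sum.atLeast1_atMost_eq[unfolded One_nat_def] lessThan_Suc_atMost)
  \<comment> \<open>With \<alpha> built from (a, p) and \<beta> from (b, m), the partial sums are
    zeta_n(p;a) and zeta_n(m;b). Symmetry equates the two evaluations, and moving the products of
    finite zeta sums to one side gives the claim.\<close>
  show ?thesis
    using double_sum_symmetric[OF summ[OF ax, of p] summ[OF bx, of m] x]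
      zeta_n_shifted_Li_suminf[OF assms(1-4) ax]
      zeta_n_shifted_Li_suminf[OF assms(2,1) assms(3)[symmetric] ab bx]
    unfolding zeta by linarith
qed

end
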